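(* Let $\to$ be the quantifier-elimination rewrite relation on formulas defined in the context. Then $\to$ is confluent: whenever $F\to^* F_1$ and $F\to^* F_2$, there is a formula $G$ with $F_1\to^* G$ and $F_2\to^* G$. Here $\to^*$ denotes the reflexive transitive closure of $\to$.
   Context: Terms and formulas are those of first-order logic extended by Hilbert's $\varepsilon$-binder. The syntax has: - individual variables; - $n$-ary formula variables (free second-order variables, never bound); - $n$-ary function and predicate symbols; - the connectives $\neg,\vee,\wedge,\Rightarrow,\dots$; - for an individual variable $x$ and a formula $F$: the term $\varepsilon x.\,F$ and the formulas $\exists x.\,F$ and $\forall x.\,F$, each binding $x$. Formulas are identified modulo renaming of bound variables. Substitution $F\{x\mapsto t\}$ is capture-avoiding. For $Q\in\{\exists,\forall\}$, write $\neg^{\forall}$ for $\neg$ and $\neg^{\exists}$ for the empty string. The relation $F_1\to F_2$ holds iff $F_2$ is obtained from $F_1$ by replacing one occurrence of a subformula $Q x.\,A$ by $A\{x\mapsto \varepsilon x.\,\neg^{Q}A\}$. The occurrence may lie anywhere in $F_1$, including inside $\varepsilon$-terms and under binders. *)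

theory Defs
  imports Main
begin

text \<open>
  Formulas modulo renaming of bound variables are represented by de Bruijn terms: an index that
  points beyond all enclosing binders stands for a free individual variable. The bodies of the
  binders \<open>Eps\<close> and \<open>Qu\<close> see the bound variable as index \<open>0\<close>.

  The type parameters are the names of function symbols (\<open>'f\<close>), predicate symbols (\<open>'p\<close>), formula
  variables (\<open>'x\<close>), and of the further connectives besides negation, disjunction, conjunction and
  implication (\<open>'c\<close>), such as equivalence or the truth constants. There is no binder for formula
  variables.
\<close>

datatype quant = Exists | Forall

datatype ('f, 'p, 'x, 'c) tm =
    Var nat
  | Fun 'f "('f, 'p, 'x, 'c) tm list"
  | Eps "('f, 'p, 'x, 'c) fm"
and ('f, 'p, 'x, 'c) fm =
    Pred 'p "('f, 'p, 'x, 'c) tm list"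
  | FVar 'x "('f, 'p, 'x, 'c) tm list"
  | Neg "('f, 'p, 'x, 'c) fm"
  | Or "('f, 'p, 'x, 'c) fm" "('f, 'p, 'x, 'c) fm"
  | And "('f, 'p, 'x, 'c) fm" "('f, 'p, 'x, 'c) fm"
  | Imp "('f, 'p, 'x, 'c) fm" "('f, 'p, 'x, 'c) fm"
  | Conn 'c "('f, 'p, 'x, 'c) fm list"
  | Qu quant "('f, 'p, 'x, 'c) fm"

text \<open>
  A name belongs to the language iff its arity is defined; the maps are partial so that each kind
  of symbol may be absent although HOL types are nonempty.
\<close>

record ('f, 'p, 'x, 'c) signature =
  fun_arity :: "'f \<rightharpoonup> nat"
  pred_arity :: "'p \<rightharpoonup> nat"
  fvar_arity :: "'x \<rightharpoonup> nat"
  conn_arity :: "'c \<rightharpoonup> nat"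

fun wf_tm :: "('f, 'p, 'x, 'c) signature \<Rightarrow> ('f, 'p, 'x, 'c) tm \<Rightarrow> bool"
and wf_fm :: "('f, 'p, 'x, 'c) signature \<Rightarrow> ('f, 'p, 'x, 'c) fm \<Rightarrow> bool" where
  "wf_tm S (Var i) \<longleftrightarrow> True"
| "wf_tm S (Fun f ts) \<longleftrightarrow> fun_arity S f = Some (length ts) \<and> (\<forall>t \<in> set ts. wf_tm S t)"
| "wf_tm S (Eps A) \<longleftrightarrow> wf_fm S A"
| "wf_fm S (Pred p ts) \<longleftrightarrow> pred_arity S p = Some (length ts) \<and> (\<forall>t \<in> set ts. wf_tm S t)"
| "wf_fm S (FVar X ts) \<longleftrightarrow> fvar_arity S X = Some (length ts) \<and> (\<forall>t \<in> set ts. wf_tm S t)"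
| "wf_fm S (Neg A) \<longleftrightarrow> wf_fm S A"
| "wf_fm S (Or A B) \<longleftrightarrow> wf_fm S A \<and> wf_fm S B"
| "wf_fm S (And A B) \<longleftrightarrow> wf_fm S A \<and> wf_fm S B"
| "wf_fm S (Imp A B) \<longleftrightarrow> wf_fm S A \<and> wf_fm S B"
| "wf_fm S (Conn c As) \<longleftrightarrow> conn_arity S c = Some (length As) \<and> (\<forall>A \<in> set As. wf_fm S A)"
| "wf_fm S (Qu q A) \<longleftrightarrow> wf_fm S A"

text \<open>\<open>lift_tm k\<close> and \<open>lift_fm k\<close> make room for a new variable with index \<open>k\<close>.\<close>

fun lift_tm :: "nat \<Rightarrow> ('f, 'p, 'x, 'c) tm \<Rightarrow> ('f, 'p, 'x, 'c) tm"
and lift_fm :: "nat \<Rightarrow> ('f, 'p, 'x, 'c) fm \<Rightarrow> ('f, 'p, 'x, 'c) fm" where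
  "lift_tm k (Var i) = Var (if i < k then i else Suc i)"
| "lift_tm k (Fun f ts) = Fun f (map (lift_tm k) ts)"
| "lift_tm k (Eps A) = Eps (lift_fm (Suc k) A)"
| "lift_fm k (Pred p ts) = Pred p (map (lift_tm k) ts)"
| "lift_fm k (FVar X ts) = FVar X (map (lift_tm k) ts)"
| "lift_fm k (Neg A) = Neg (lift_fm k A)"
| "lift_fm k (Or A B) = Or (lift_fm k A) (lift_fm k B)"
| "lift_fm k (And A B) = And (lift_fm k A) (lift_fm k B)"
| "lift_fm k (Imp A B) = Imp (lift_fm k A) (lift_fm k B)"
| "lift_fm k (Conn c As) = Conn c (map (lift_fm k) As)"
| "lift_fm k (Qu q A) = Qu q (lift_fm (Suc k) A)"

text \<open>
  \<open>subst_fm k s A\<close> replaces the variable with index \<open>k\<close> by \<open>s\<close> and removes that variable from the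
  context, so the indices above \<open>k\<close> drop by one.
\<close>

fun subst_tm :: "nat \<Rightarrow> ('f, 'p, 'x, 'c) tm \<Rightarrow> ('f, 'p, 'x, 'c) tm \<Rightarrow> ('f, 'p, 'x, 'c) tm"
and subst_fm :: "nat \<Rightarrow> ('f, 'p, 'x, 'c) tm \<Rightarrow> ('f, 'p, 'x, 'c) fm \<Rightarrow> ('f, 'p, 'x, 'c) fm" where
  "subst_tm k s (Var i) = (if i < k then Var i else if i = k then s else Var (i - 1))"
| "subst_tm k s (Fun f ts) = Fun f (map (subst_tm k s) ts)"
| "subst_tm k s (Eps A) = Eps (subst_fm (Suc k) (lift_tm 0 s) A)"
| "subst_fm k s (Pred p ts) = Pred p (map (subst_tm k s) ts)"
| "subst_fm k s (FVar X ts) = FVar X (map (subst_tm k s) ts)"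
| "subst_fm k s (Neg A) = Neg (subst_fm k s A)"
| "subst_fm k s (Or A B) = Or (subst_fm k s A) (subst_fm k s B)"
| "subst_fm k s (And A B) = And (subst_fm k s A) (subst_fm k s B)"
| "subst_fm k s (Imp A B) = Imp (subst_fm k s A) (subst_fm k s B)"
| "subst_fm k s (Conn c As) = Conn c (map (subst_fm k s) As)"
| "subst_fm k s (Qu q A) = Qu q (subst_fm (Suc k) (lift_tm 0 s) A)"

fun neg_quant :: "quant \<Rightarrow> ('f, 'p, 'x, 'c) fm \<Rightarrow> ('f, 'p, 'x, 'c) fm" where
  "neg_quant Exists A = A"
| "neg_quant Forall A = Neg A"

text \<open>
  The function \<open>neg_quant q\<close> is the prefix that is \<open>\<not>\<close> for the universal quantifier and empty for
  the existential one. In rule \<open>elim\<close> the term \<open>Eps (neg_quant q A)\<close> needs no lifting: the index \<open>0\<close> that the quantifier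
  binds in \<open>A\<close> is bound in this term by \<open>Eps\<close>, and the term lives outside the quantifier. The other
  rules close \<open>elim\<close> under replacement of a single occurrence at an arbitrary position.
\<close>

inductive step_tm :: "('f, 'p, 'x, 'c) tm \<Rightarrow> ('f, 'p, 'x, 'c) tm \<Rightarrow> bool"
and step_fm :: "('f, 'p, 'x, 'c) fm \<Rightarrow> ('f, 'p, 'x, 'c) fm \<Rightarrow> bool" where
  elim: "step_fm (Qu q A) (subst_fm 0 (Eps (neg_quant q A)) A)"
| in_Fun: "step_tm t t' \<Longrightarrow> step_tm (Fun f (ts @ t # us)) (Fun f (ts @ t' # us))"
| in_Eps: "step_fm A A' \<Longrightarrow> step_tm (Eps A) (Eps A')"
| in_Pred: "step_tm t t' \<Longrightarrow> step_fm (Pred p (ts @ t # us)) (Pred p (ts @ t' # us))"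
| in_FVar: "step_tm t t' \<Longrightarrow> step_fm (FVar X (ts @ t # us)) (FVar X (ts @ t' # us))"
| in_Neg: "step_fm A A' \<Longrightarrow> step_fm (Neg A) (Neg A')"
| in_Or1: "step_fm A A' \<Longrightarrow> step_fm (Or A B) (Or A' B)"
| in_Or2: "step_fm B B' \<Longrightarrow> step_fm (Or A B) (Or A B')"
| in_And1: "step_fm A A' \<Longrightarrow> step_fm (And A B) (And A' B)"
| in_And2: "step_fm B B' \<Longrightarrow> step_fm (And A B) (And A B')"
| in_Imp1: "step_fm A A' \<Longrightarrow> step_fm (Imp A B) (Imp A' B)"
| in_Imp2: "step_fm B B' \<Longrightarrow> step_fm (Imp A B) (Imp A B')"
| in_Conn: "step_fm A A' \<Longrightarrow> step_fm (Conn c (As @ A # Bs)) (Conn c (As @ A' # Bs))"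
| in_Qu: "step_fm A A' \<Longrightarrow> step_fm (Qu q A) (Qu q A')"

end

(*
  The complete expansion nf eliminates all quantifiers, innermost first. Every formula rewrites to
  its expansion, and since nf commutes with substitution, a rewrite step does not change the
  expansion. Hence nf F is a common reduct of all reducts of F.
*)
theory Submission
  imports Defs
begin

lemma lift_lift:
  fixes t :: "('f, 'p, 'x, 'c) tm" and A :: "('f, 'p, 'x, 'c) fm"
  shows "i \<le> k \<Longrightarrow> lift_tm (Suc k) (lift_tm i t) = lift_tm i (lift_tm k t)"
    and "i \<le> k \<Longrightarrow> lift_fm (Suc k) (lift_fm i A) = lift_fm i (lift_fm k A)"
  by (induction t and A arbitrary: i k and i k rule: tm.induct fm.induct) auto

lemma subst_lift_cancel:
  fixes t :: "('f, 'p, 'x, 'c) tm" and A :: "('f, 'p, 'x, 'c) fm"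
  shows "subst_tm k s (lift_tm k t) = t"
    and "subst_fm k s (lift_fm k A) = A"
  by (induction t and A arbitrary: k s and k s rule: tm.induct fm.induct) (auto simp: map_idI)

lemma lift_subst_le:
  fixes t :: "('f, 'p, 'x, 'c) tm" and A :: "('f, 'p, 'x, 'c) fm"
  shows "i \<le> k \<Longrightarrow> lift_tm i (subst_tm k s t) = subst_tm (Suc k) (lift_tm i s) (lift_tm i t)"
    and "i \<le> k \<Longrightarrow> lift_fm i (subst_fm k s A) = subst_fm (Suc k) (lift_tm i s) (lift_fm i A)"
  by (induction t and A arbitrary: i k s and i k s rule: tm.induct fm.induct) (auto simp: lift_lift)

text \<open>The new variable comes to lie above the removed index \<open>k\<close>, so before the
  removal its place is \<open>Suc i\<close>. The case \<open>k = 0\<close> moves a lifting past the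
  contraction of a quantifier.\<close>

lemma lift_subst_ge:
  fixes t :: "('f, 'p, 'x, 'c) tm" and A :: "('f, 'p, 'x, 'c) fm"
  shows "k \<le> i \<Longrightarrow> lift_tm i (subst_tm k s t) = subst_tm k (lift_tm i s) (lift_tm (Suc i) t)"
    and "k \<le> i \<Longrightarrow> lift_fm i (subst_fm k s A) = subst_fm k (lift_tm i s) (lift_fm (Suc i) A)"
  by (induction t and A arbitrary: i k s and i k s rule: tm.induct fm.induct) (auto simp: lift_lift)

text \<open>The de Bruijn form of the substitution lemma. Before index \<open>i\<close> is removed,
  the variable \<open>k\<close> is called \<open>Suc k\<close> and \<open>u\<close> has to skip
  \<open>i\<close>, hence the lifting; for this variable the outer substitution at \<open>i\<close>
  then cancels the lifting of \<open>u\<close>.\<close>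

lemma subst_subst:
  fixes t :: "('f, 'p, 'x, 'c) tm" and A :: "('f, 'p, 'x, 'c) fm"
  shows "i \<le> k \<Longrightarrow> subst_tm k u (subst_tm i s t)
      = subst_tm i (subst_tm k u s) (subst_tm (Suc k) (lift_tm i u) t)"
    and "i \<le> k \<Longrightarrow> subst_fm k u (subst_fm i s A)
      = subst_fm i (subst_tm k u s) (subst_fm (Suc k) (lift_tm i u) A)"
  by (induction t and A arbitrary: i k s u and i k s u rule: tm.induct fm.induct)
    (auto simp: lift_lift lift_subst_le subst_lift_cancel)

lemma lift_neg_quant: "lift_fm k (neg_quant q A) = neg_quant q (lift_fm k A)"
  by (cases q) auto

lemma subst_neg_quant: "subst_fm k s (neg_quant q A) = neg_quant q (subst_fm k s A)"
  by (cases q) auto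

lemma wf_lift:
  fixes t :: "('f, 'p, 'x, 'c) tm" and A :: "('f, 'p, 'x, 'c) fm"
  shows "wf_tm S t \<Longrightarrow> wf_tm S (lift_tm k t)"
    and "wf_fm S A \<Longrightarrow> wf_fm S (lift_fm k A)"
  by (induction t and A arbitrary: k and k rule: tm.induct fm.induct) auto

lemma wf_subst:
  fixes t :: "('f, 'p, 'x, 'c) tm" and A :: "('f, 'p, 'x, 'c) fm"
  shows "wf_tm S s \<Longrightarrow> wf_tm S t \<Longrightarrow> wf_tm S (subst_tm k s t)"
    and "wf_tm S s \<Longrightarrow> wf_fm S A \<Longrightarrow> wf_fm S (subst_fm k s A)"
  by (induction t and A arbitrary: k s and k s rule: tm.induct fm.induct) (auto simp: wf_lift)

lemma wf_neg_quant: "wf_fm S (neg_quant q A) \<longleftrightarrow> wf_fm S A"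
  by (cases q) auto

text \<open>The clause for \<open>Qu\<close> expands the body before contracting, which keeps the
  recursion structural. Substituting a quantifier-free term into a quantifier-free formula creates
  no quantifier, so the result is quantifier-free.\<close>

fun nf_tm :: "('f, 'p, 'x, 'c) tm \<Rightarrow> ('f, 'p, 'x, 'c) tm"
and nf_fm :: "('f, 'p, 'x, 'c) fm \<Rightarrow> ('f, 'p, 'x, 'c) fm" where
  "nf_tm (Var i) = Var i"
| "nf_tm (Fun f ts) = Fun f (map nf_tm ts)"
| "nf_tm (Eps A) = Eps (nf_fm A)"
| "nf_fm (Pred p ts) = Pred p (map nf_tm ts)"
| "nf_fm (FVar X ts) = FVar X (map nf_tm ts)"
| "nf_fm (Neg A) = Neg (nf_fm A)"
| "nf_fm (Or A B) = Or (nf_fm A) (nf_fm B)"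
| "nf_fm (And A B) = And (nf_fm A) (nf_fm B)"
| "nf_fm (Imp A B) = Imp (nf_fm A) (nf_fm B)"
| "nf_fm (Conn c As) = Conn c (map nf_fm As)"
| "nf_fm (Qu q A) = subst_fm 0 (Eps (neg_quant q (nf_fm A))) (nf_fm A)"

lemma nf_neg_quant: "nf_fm (neg_quant q A) = neg_quant q (nf_fm A)"
  by (cases q) auto

lemma nf_lift:
  fixes t :: "('f, 'p, 'x, 'c) tm" and A :: "('f, 'p, 'x, 'c) fm"
  shows "nf_tm (lift_tm k t) = lift_tm k (nf_tm t)"
    and "nf_fm (lift_fm k A) = lift_fm k (nf_fm A)"
  by (induction t and A arbitrary: k and k rule: tm.induct fm.induct)
    (auto simp: lift_subst_ge lift_neg_quant)

text \<open>At a quantifier, the outer substitution has to pass the contraction. This is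
  \<open>subst_subst\<close> with inner index 0: it sends the inserted \<epsilon>-term to the
  \<epsilon>-term of the substituted body. Under binders \<open>s\<close> is lifted, which calls for
  \<open>nf_lift\<close>.\<close>

lemma nf_subst:
  fixes t :: "('f, 'p, 'x, 'c) tm" and A :: "('f, 'p, 'x, 'c) fm"
  shows "nf_tm (subst_tm k s t) = subst_tm k (nf_tm s) (nf_tm t)"
    and "nf_fm (subst_fm k s A) = subst_fm k (nf_tm s) (nf_fm A)"
  by (induction t and A arbitrary: k s and k s rule: tm.induct fm.induct)
    (auto simp: nf_lift subst_subst subst_neg_quant)

text \<open>Expansion only adds \<open>Neg\<close>, \<open>Eps\<close> and copies of subterms, so it
  brings in no symbol outside \<open>S\<close>. This keeps the common reduct in the
  language.\<close>

lemma wf_nf: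
  fixes t :: "('f, 'p, 'x, 'c) tm" and A :: "('f, 'p, 'x, 'c) fm"
  shows "wf_tm S t \<Longrightarrow> wf_tm S (nf_tm t)"
    and "wf_fm S A \<Longrightarrow> wf_fm S (nf_fm A)"
  by (induction t and A rule: tm.induct fm.induct) (auto simp: wf_subst wf_neg_quant)

text \<open>In the case \<open>elim\<close>, the expansion of the redex holds by definition, and
  that of the contractum agrees with it by \<open>nf_subst\<close>. In the other cases the expansion
  of the whole depends on the replaced part only through the expansion of that part.\<close>

lemma nf_step:
  fixes t t' :: "('f, 'p, 'x, 'c) tm" and A A' :: "('f, 'p, 'x, 'c) fm"
  shows "step_tm t t' \<Longrightarrow> nf_tm t = nf_tm t'"
    and "step_fm A A' \<Longrightarrow> nf_fm A = nf_fm A'"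
  by (induction t t' and A A' rule: step_tm_step_fm.inducts) (auto simp: nf_subst nf_neg_quant)

lemma nf_steps: "step_fm\<^sup>*\<^sup>* A A' \<Longrightarrow> nf_fm A = nf_fm A'"
  by (induction rule: rtranclp_induct) (auto dest: nf_step)

lemma rtranclp_context:
  assumes "r\<^sup>*\<^sup>* x y" and "\<And>x y. r x y \<Longrightarrow> R (C x) (C y)"
  shows "R\<^sup>*\<^sup>* (C x) (C y)"
  using assms(1)
  by (induction rule: rtranclp_induct) (auto intro: rtranclp.rtrancl_into_rtrancl assms(2))

text \<open>The list is rewritten from left to right. The prefix \<open>us\<close> holds the
  finished entries and therefore varies in the induction.\<close>

lemma rtranclp_map:
  assumes "\<And>x. x \<in> set xs \<Longrightarrow> r\<^sup>*\<^sup>* x (f x)"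
    and "\<And>x y us vs. r x y \<Longrightarrow> R (C (us @ x # vs)) (C (us @ y # vs))"
  shows "R\<^sup>*\<^sup>* (C (us @ xs)) (C (us @ map f xs))"
  using assms(1)
proof (induction xs arbitrary: us)
  case Nil
  then show ?case by simp
next
  case (Cons x xs)
  have "R\<^sup>*\<^sup>* (C (us @ x # xs)) (C (us @ f x # xs))"
    using Cons.prems[of x]
    by (intro rtranclp_context[where C = "\<lambda>x. C (us @ x # xs)" and r = r]) (auto intro: assms(2))
  also have "R\<^sup>*\<^sup>* (C (us @ f x # xs)) (C (us @ f x # map f xs))"
    \<comment> \<open>The entry just finished joins the prefix.\<close>
    using Cons.IH[of "us @ [f x]"] Cons.prems by simp
  finally show ?case by simp
qed

lemma steps_binary:
  assumes "step_fm\<^sup>*\<^sup>* A A'" and "step_fm\<^sup>*\<^sup>* B B'"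
    and "\<And>A A' B. step_fm A A' \<Longrightarrow> step_fm (C A B) (C A' B)"
    and "\<And>A B B'. step_fm B B' \<Longrightarrow> step_fm (C A B) (C A B')"
  shows "step_fm\<^sup>*\<^sup>* (C A B) (C A' B')"
proof (rule rtranclp_trans)
  show "step_fm\<^sup>*\<^sup>* (C A B) (C A' B)"
    using assms(1,3) by (rule rtranclp_context[where C = "\<lambda>A. C A B"])
  show "step_fm\<^sup>*\<^sup>* (C A' B) (C A' B')"
    using assms(2,4) by (rule rtranclp_context)
qed

lemma steps_nf:
  fixes t :: "('f, 'p, 'x, 'c) tm" and A :: "('f, 'p, 'x, 'c) fm"
  shows "step_tm\<^sup>*\<^sup>* t (nf_tm t)"
    and "step_fm\<^sup>*\<^sup>* A (nf_fm A)"
proof (induction t and A rule: tm.induct fm.induct)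
  case (Var i)
  then show ?case by simp
next
  case (Fun f ts)
  show ?case
    using rtranclp_map[where us = "[]" and C = "Fun f" and r = step_tm and R = step_tm and f = nf_tm, OF Fun in_Fun]
    by simp
next
  case (Eps A)
  show ?case
    using rtranclp_context[where C = Eps and r = step_fm and R = step_tm, OF Eps in_Eps] by simp
next
  case (Pred p ts)
  show ?case
    using rtranclp_map[where us = "[]" and C = "Pred p" and r = step_tm and R = step_fm and f = nf_tm, OF Pred in_Pred]
    by simp
next
  case (FVar X ts)
  show ?case
    using rtranclp_map[where us = "[]" and C = "FVar X" and r = step_tm and R = step_fm and f = nf_tm, OF FVar in_FVar]
    by simp
next
  case (Neg A)
  show ?case
    using rtranclp_context[where C = Neg and r = step_fm and R = step_fm, OF Neg in_Neg] by simp
next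
  case (Or A B)
  show ?case
    using steps_binary[where C = Or, OF Or in_Or1 in_Or2] by simp
next
  case (And A B)
  show ?case
    using steps_binary[where C = And, OF And in_And1 in_And2] by simp
next
  case (Imp A B)
  show ?case
    using steps_binary[where C = Imp, OF Imp in_Imp1 in_Imp2] by simp
next
  case (Conn c As)
  show ?case
    using rtranclp_map[where us = "[]" and C = "Conn c" and r = step_fm and R = step_fm and f = nf_fm, OF Conn in_Conn]
    by simp
next
  case (Qu q A)
  have "step_fm\<^sup>*\<^sup>* (Qu q A) (Qu q (nf_fm A))"
    using rtranclp_context[where C = "Qu q" and r = step_fm and R = step_fm, OF Qu in_Qu] .
  \<comment> \<open>With the body already expanded, one elimination yields exactly the
    \<open>Qu\<close> clause of \<open>nf_fm\<close>; no copy of the body needs further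
    rewriting.\<close>
  also have "step_fm (Qu q (nf_fm A)) (nf_fm (Qu q A))"
    using elim[of q "nf_fm A"] by simp
  finally show ?case .
qed

theorem theorem3p8:
  fixes S :: "('f, 'p, 'x, 'c) signature"
    and F F\<^sub>1 F\<^sub>2 :: "('f, 'p, 'x, 'c) fm"
  assumes "wf_fm S F"
    and "step_fm\<^sup>*\<^sup>* F F\<^sub>1"
    and "step_fm\<^sup>*\<^sup>* F F\<^sub>2"
  shows "\<exists>G. wf_fm S G \<and> step_fm\<^sup>*\<^sup>* F\<^sub>1 G \<and> step_fm\<^sup>*\<^sup>* F\<^sub>2 G"
proof (intro exI conjI)
  show "wf_fm S (nf_fm F)"
    using assms(1) by (rule wf_nf)
  \<comment> \<open>\<open>F\<^sub>1\<close> rewrites to its own expansion, which is that of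
    \<open>F\<close> by invariance along the rewrite sequence.\<close>
  show "step_fm\<^sup>*\<^sup>* F\<^sub>1 (nf_fm F)"
    using steps_nf(2)[of F\<^sub>1] nf_steps[OF assms(2)] by simp
  show "step_fm\<^sup>*\<^sup>* F\<^sub>2 (nf_fm F)"
    using steps_nf(2)[of F\<^sub>2] nf_steps[OF assms(3)] by simp
qed

end
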